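(* Let $(U_i)_{i\ge0}$ be defined by $U_0=1$, $U_1=13$, $U_2=163$ and $U_{i+3}=12U_{i+2}+6U_{i+1}+12U_i$ for all $i\ge0$. Then for all $i\ge0$, $$\nu_3(U_i)=\left\lfloor\frac{i}{3}\right\rfloor+\begin{cases}1&\text{if } i\equiv4\pmod 9,\\0&\text{if } i\not\equiv4\pmod 9.\end{cases}$$
   Context: $\nu_3(n)$ denotes the $3$-adic valuation of the non-zero integer $n$ (the exponent of the highest power of $3$ dividing $n$). *)

theory Defs
  imports "HOL-Computational_Algebra.Primes"
begin

end

theory Submission
  imports Defs
begin

text \<open>
  Cut the sequence into blocks of nine consecutive terms. After division by \<open>27 ^ m\<close>, the first
  three terms \<open>(a, b, c)\<close> of the \<open>m\<close>-th block satisfy \<open>a \<equiv> 1 (mod 9)\<close>, \<open>b \<equiv> 1 (mod 3)\<close> and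
  \<open>c \<equiv> b + 6 (mod 9)\<close>. These congruences persist from one block to the next, and they are strong
  enough to determine the 3-adic valuation of each of the nine terms of a block.
\<close>

text \<open>The cofactor \<open>d + 3 * c\<close> is congruent to \<open>d\<close> modulo 3. With a
  numeral for \<open>d\<close>, the unknowns sit inside \<open>c\<close> and the side condition is
  pure arithmetic.\<close>

lemma multiplicity_3_eqI:
  fixes x c d :: int
  assumes "x = 3 ^ k * (d + 3 * c)" and "d mod 3 \<noteq> 0"
  shows "multiplicity 3 x = k"
proof -
  have "\<not> 3 dvd d + 3 * c"
    using assms(2) by (simp add: dvd_eq_mod_eq_0)
  then show ?thesis
    using assms(1) by (intro multiplicity_eqI) auto
qed

locale U_recurrence =
  fixes U :: "nat \<Rightarrow> int"
  assumes init: "U 0 = 1" "U 1 = 13" "U 2 = 163"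
    and rec: "\<And>i. U (i + 3) = 12 * U (i + 2) + 6 * U (i + 1) + 12 * U i"
begin

text \<open>The recurrence is linear, so \<open>p\<close> factors out. In each cofactor 3 divides
  the coefficients of \<open>s\<close>, \<open>t\<close>, \<open>r\<close> but not the constant, so
  the extracted power of 3 is exact. At \<open>n + 4\<close> this relies on sharing \<open>t\<close>
  between the second and third terms: it makes the coefficient of \<open>t\<close> there 9 *
  78.\<close>

lemma block:
  assumes "U n = p * (1 + 9 * s)" "U (n + 1) = p * (1 + 3 * t)" "U (n + 2) = p * (7 + 3 * t + 9 * r)"
  shows "U (n + 3) = p * 3 * (34 + 36 * s + 18 * t + 36 * r)"
    and "U (n + 4) = p * 9 * (142 + 144 * s + 78 * t + 150 * r)"
    and "U (n + 5) = p * 3 * (5344 + 5400 * s + 2928 * t + 5652 * r)"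
    and "U (n + 6) = p * 9 * (22364 + 22608 * s + 12252 * t + 23652 * r)"
    and "U (n + 7) = p * 9 * (280760 + 283824 * s + 153816 * t + 296928 * r)"
    and "U (n + 8) = p * 9 * (3524680 + 3563136 * s + 1931016 * t + 3727656 * r)"
proof -
  show 3: "U (n + 3) = p * 3 * (34 + 36 * s + 18 * t + 36 * r)"
    using rec[of n] assms by (simp add: algebra_simps)
  show 4: "U (n + 4) = p * 9 * (142 + 144 * s + 78 * t + 150 * r)"
    using rec[of "n + 1"] assms 3 by (simp add: eval_nat_numeral algebra_simps)
  show 5: "U (n + 5) = p * 3 * (5344 + 5400 * s + 2928 * t + 5652 * r)"
    using rec[of "n + 2"] assms 3 4 by (simp add: eval_nat_numeral algebra_simps)
  show 6: "U (n + 6) = p * 9 * (22364 + 22608 * s + 12252 * t + 23652 * r)"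
    using rec[of "n + 3"] 3 4 5 by (simp add: algebra_simps)
  show 7: "U (n + 7) = p * 9 * (280760 + 283824 * s + 153816 * t + 296928 * r)"
    using rec[of "n + 4"] 4 5 6 by (simp add: algebra_simps)
  show 8: "U (n + 8) = p * 9 * (3524680 + 3563136 * s + 1931016 * t + 3727656 * r)"
    using rec[of "n + 5"] 5 6 7 by (simp add: algebra_simps)
qed

lemma block_start:
  "\<exists>s t r. U (9 * m) = 27 ^ m * (1 + 9 * s) \<and> U (9 * m + 1) = 27 ^ m * (1 + 3 * t) \<and>
     U (9 * m + 2) = 27 ^ m * (7 + 3 * t + 9 * r)"
proof (induction m)
  case 0
  have "U 0 = 27 ^ 0 * (1 + 9 * 0) \<and> U 1 = 27 ^ 0 * (1 + 3 * 4) \<and> U 2 = 27 ^ 0 * (7 + 3 * 4 + 9 * 16)"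
    using init by simp
  then show ?case by (metis add_0 mult_0_right)
next
  case (Suc m)
  then obtain s t r where *: "U (9 * m) = 27 ^ m * (1 + 9 * s)"
    "U (9 * m + 1) = 27 ^ m * (1 + 3 * t)" "U (9 * m + 2) = 27 ^ m * (7 + 3 * t + 9 * r)"
    by blast
  \<comment> \<open>These solve the three equations below for the next block's parameters; that all
    coefficients are integers is the persistence of the congruences.\<close>
  define s' where "s' = 1638855 + 1656736 * s + 897856 * t + 1733232 * r"
  define t' where "t' = 61722917 + 62396352 * s + 33815248 * t + 65277360 * r"
  define r' where "r' = 237717018 + 240310656 * s + 130234608 * t + 251406448 * r"
  \<comment> \<open>The factor 27 appears because terms 6, 7, 8 carry \<open>p * 9\<close> and the
    coefficients 12, 6, 12 are multiples of 3.\<close>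
  have 9: "U (9 * m + 9) = 27 ^ Suc m * (1 + 9 * s')"
    using rec[of "9 * m + 6"] block[OF *] by (simp add: s'_def algebra_simps)
  have 10: "U (9 * m + 10) = 27 ^ Suc m * (1 + 3 * t')"
    using rec[of "9 * m + 7"] block[OF *] 9 by (simp add: s'_def t'_def algebra_simps)
  have 11: "U (9 * m + 11) = 27 ^ Suc m * (7 + 3 * t' + 9 * r')"
    using rec[of "9 * m + 8"] block[OF *] 9 10 by (simp add: s'_def t'_def r'_def algebra_simps)
  have "9 * Suc m = 9 * m + 9" "9 * Suc m + 1 = 9 * m + 10" "9 * Suc m + 2 = 9 * m + 11"
    by simp_all
  with 9 10 11 show ?case by metis
qed

lemma multiplicity_block:
  assumes "j < 9"
  shows "multiplicity 3 (U (9 * m + j)) = 3 * m + j div 3 + (if j = 4 then 1 else 0)"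
proof -
  obtain s t r where *: "U (9 * m) = 27 ^ m * (1 + 9 * s)"
    "U (9 * m + 1) = 27 ^ m * (1 + 3 * t)" "U (9 * m + 2) = 27 ^ m * (7 + 3 * t + 9 * r)"
    using block_start by blast
  have p: "(27 :: int) ^ m = 3 ^ (3 * m)"
    by (simp add: power_mult)
  note U = *[unfolded p] block[OF *, unfolded p]
  consider "j = 0" | "j = 1" | "j = 2" | "j = 3" | "j = 4" | "j = 5" | "j = 6" | "j = 7" | "j = 8"
    using assms by linarith
  then show ?thesis
  proof cases
    \<comment> \<open>Cases count from 1, so case 1 is \<open>j = 0\<close>. Each \<open>c\<close>
      is the cofactor minus its residue \<open>d\<close>, divided by 3.\<close>
    case 1
    show ?thesis unfolding 1
      by (rule multiplicity_3_eqI[where d = 1 and c = "3 * s"])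
        (use U in \<open>simp_all add: power_add algebra_simps\<close>)
  next
    case 2
    show ?thesis unfolding 2
      by (rule multiplicity_3_eqI[where d = 1 and c = "t"])
        (use U in \<open>simp_all add: power_add algebra_simps\<close>)
  next
    case 3
    show ?thesis unfolding 3
      by (rule multiplicity_3_eqI[where d = 1 and c = "2 + t + 3 * r"])
        (use U in \<open>simp_all add: power_add algebra_simps\<close>)
  next
    case 4
    show ?thesis unfolding 4
      by (rule multiplicity_3_eqI[where d = 1 and c = "11 + 12 * s + 6 * t + 12 * r"])
        (use U in \<open>simp_all add: power_add algebra_simps\<close>)
  next
    \<comment> \<open>Here \<open>j = 4\<close>: the exponent is 2 although
      \<open>4 div 3 = 1\<close>, the exceptional case of the formula.\<close>
    case 5
    show ?thesis unfolding 5
      by (rule multiplicity_3_eqI[where d = 1 and c = "47 + 48 * s + 26 * t + 50 * r"])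
        (use U in \<open>simp_all add: power_add algebra_simps\<close>)
  next
    case 6
    show ?thesis unfolding 6
      by (rule multiplicity_3_eqI[where d = 1 and c = "1781 + 1800 * s + 976 * t + 1884 * r"])
        (use U in \<open>simp_all add: power_add algebra_simps\<close>)
  next
    case 7
    show ?thesis unfolding 7
      by (rule multiplicity_3_eqI[where d = 2 and c = "7454 + 7536 * s + 4084 * t + 7884 * r"])
        (use U in \<open>simp_all add: power_add algebra_simps\<close>)
  next
    case 8
    show ?thesis unfolding 8
      by (rule multiplicity_3_eqI[where d = 2 and c = "93586 + 94608 * s + 51272 * t + 98976 * r"])
        (use U in \<open>simp_all add: power_add algebra_simps\<close>)
  next
    case 9
    show ?thesis unfolding 9
      by (rule multiplicity_3_eqI[where d = 1 and c = "1174893 + 1187712 * s + 643672 * t + 1242552 * r"])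
        (use U in \<open>simp_all add: power_add algebra_simps\<close>)
  qed
qed

end

theorem theorem6p1:
  fixes U :: "nat \<Rightarrow> int"
  assumes "U 0 = 1" and "U 1 = 13" and "U 2 = 163"
    and "\<And>i. U (i + 3) = 12 * U (i + 2) + 6 * U (i + 1) + 12 * U i"
  shows "\<forall>i. multiplicity 3 (U i) = i div 3 + (if i mod 9 = 4 then 1 else 0)"
proof
  fix i :: nat
  interpret U_recurrence U
    using assms by unfold_locales
  \<comment> \<open>Since 3 divides 9, the quotient splits along
    \<open>i = 9 * (i div 9) + i mod 9\<close>.\<close>
  have "i div 3 = 3 * (i div 9) + i mod 9 div 3"
    by presburger
  then show "multiplicity 3 (U i) = i div 3 + (if i mod 9 = 4 then 1 else 0)"
    using multiplicity_block[of "i mod 9" "i div 9"] by simp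
qed

end
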